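(* Let $v\geq2$, $d\in\{1,\ldots,v-1\}$ and $m\in\{1,\ldots,\binom{v}{d}\}$ be integers. Let $\mathsf C$ be the simplicial complex of all non-empty subsets of $\{1,\ldots,v\}$ of cardinality at most $d+1$, let $\mathsf C_{d-1}$ be its set of $(d-1)$-cells (subsets of cardinality $d$), and let $\mathsf E$ be the set of ordered pairs $(\sigma,\tau')$ of adjacent elements of $\mathsf C_{d-1}$, i.e. such that $\sigma\cup\tau'$ is a $d$-cell (has cardinality $d+1$); write $\sigma\sim\tau'$. Let $H$ be a (not necessarily commutative) ring, $K$ a commutative ring, and $\tau:H\to K$ a central morphism of $\mathbb Z$-modules, that is, an additive map such that $\tau(rr')=\tau(r'r)$ for all $r,r'\in H$. For each $(\sigma,\tau')\in\mathsf E$ let $h_{\sigma\tau'}\in H$ and let $a_{\sigma\tau'}$ be an indeterminate. Fix an arbitrary orientation of each $(d-1)$-cell, with associated signs $\varepsilon_{\sigma\tau'}\in\{\pm1\}$ for $(\sigma,\tau')\in\mathsf E$. Let $\Delta$ be the matrix indexed by $\mathsf C_{d-1}$ (with some fixed ordering of $\mathsf C_{d-1}$) whose non-zero entries are $$\Delta_{\sigma\tau'}=-\varepsilon_{\sigma\tau'}h_{\sigma\tau'}a_{\sigma\tau'}\quad\text{for }(\sigma,\tau')\in\mathsf E,\qquad \Delta_{\sigma\sigma}=\frac1d\sum_{\substack{\tau'\in\mathsf C_{d-1}\setminus\{\sigma\}\\ \tau'\sim\sigma}}a_{\sigma\tau'}\quad\text{for }\sigma\in\mathsf C_{d-1}.$$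 Let $\Delta_{[m]}$ be the principal submatrix of $\Delta$ indexed by the first $m$ elements of $\mathsf C_{d-1}$. Then in the ring $S=K[a_{\sigma\tau'}:(\sigma,\tau')\in\mathsf E]$ we have $$\det\nolimits_{\tau}\Delta_{[m]}=\frac1{d^m}\sum_{F\in\mathcal F_m}a_F\prod_{c\in\mathcal C(F)}\bigl(1-d^{\ell(c)}\varepsilon_c\,\tau(h_c)\bigr).$$
   Context: Polynomial rings: $R=H[a_{\sigma\tau'}:(\sigma,\tau')\in\mathsf E]$ is the polynomial ring over $H$ in indeterminates which commute with each other and with $H$. The map $\tau$ is extended coefficientwise to an additive map $R\to S$, still denoted $\tau$. $\tau$-determinant: for an integer $p\geq1$ and a $p\times p$ matrix $M$ with entries in $R$, $$\det\nolimits_\tau(M)=\sum_{\pi\in\mathfrak S_p}\varepsilon(\pi)\prod_{\substack{c\text{ cycle of }\pi\\ c=(i_1\ldots i_r)}}\tau\bigl(M_{i_1i_2}M_{i_2i_3}\cdots M_{i_ri_1}\bigr)\in S,$$ where $\mathfrak S_p$ is the symmetric group on $p$ elements, $\varepsilon(\pi)$ is the signature, and fixed points count as cycles of length $1$ (this is well defined because $\tau$ is central). Signs: for $\sigma\sim\tau'$ with $\rho=\sigma\cup\tau'$, $\varepsilon_{\sigma\tau'}=-[\rho:\sigma][\rho:\tau']$, where $[\rho:\sigma]\in\{\pm1\}$ is the incidence number, i.e. the coefficient of the oriented cell $\sigma$ in the simplicial boundary of $\rho$ (for any orientation of $\rho$; the product does not depend on it). For a cyclic sequence $c=(\sigma_1\ldots\sigma_k)$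 of $(d-1)$-cells with $\sigma_j\sim\sigma_{j+1}$ and $\sigma_k\sim\sigma_1$, $\varepsilon_c=\varepsilon_{\sigma_1\sigma_2}\cdots\varepsilon_{\sigma_{k-1}\sigma_k}\varepsilon_{\sigma_k\sigma_1}$, which does not depend on the choice of orientations of the cells $\sigma_j$. Forests: consider the directed graph $(\mathsf C_{d-1},\mathsf E)$, the edge $(\sigma,\tau')$ going from $\sigma$ to $\tau'$. Let $\mathsf U$ be the set of the first $m$ elements of $\mathsf C_{d-1}$ and let the well be $\mathsf W=\mathsf C_{d-1}\setminus\mathsf U$. $\mathcal F_m$ is the set of cycle-and-well-rooted spanning forests, i.e. subsets $F\subset\mathsf E$ containing exactly $m$ edges, one coming out of each $\sigma\in\mathsf U$. For $F\in\mathcal F_m$, $a_F=\prod_{(\sigma,\tau')\in F}a_{\sigma\tau'}$. Each connected component of $F$ is either a tree rooted at a vertex of $\mathsf W$ with all edges pointing towards the root, or contained in $\mathsf U$ and contains exactly one directed cycle; $\mathcal C(F)$ is the (possibly empty) set of directed cycles of $F$. For $c\in\mathcal C(F)$ visiting $\sigma_1,\ldots,\sigma_r$ in this cyclic order, $\ell(c)=r$ and $\tau(h_c)=\tau(h_{\sigma_1\sigma_2}h_{\sigma_2\sigma_3}\cdots h_{\sigma_r\sigma_1})$, which does not depend on the starting point.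
   Formalization: The formal theorem also assumes τ(1)=1 (without it the identity fails, e.g. τ=0 and m=1, where the left side is 0 but the right side is not) and that d is invertible in H, so that 1/d in Δ makes sense; rings are taken non-zero. *)

theory Defs
  imports Complex_Main "HOL-Library.Poly_Mapping" "HOL-Combinatorics.Permutations"
begin

section \<open>Polynomials over a possibly non-commutative ring\<close>

text \<open>
  A polynomial is a finitely supported family of coefficients indexed by monomials, and a
  monomial is a finitely supported family of exponents. In the product of the monoid algebra
  the indeterminates commute with each other and with the coefficients, while the
  coefficients need not commute.
\<close>

type_synonym ('i, 'r) mvpoly = "('i \<Rightarrow>\<^sub>0 nat) \<Rightarrow>\<^sub>0 'r"

definition Const :: "'r \<Rightarrow> ('i, 'r::zero) mvpoly" where
  "Const r = Poly_Mapping.single 0 r"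

definition Var :: "'i \<Rightarrow> ('i, 'r::zero_neq_one) mvpoly" where
  "Var i = Poly_Mapping.single (Poly_Mapping.single i 1) 1"

definition coeffwise :: "('h::zero \<Rightarrow> 'k::zero) \<Rightarrow> ('i, 'h) mvpoly \<Rightarrow> ('i, 'k) mvpoly" where
  "coeffwise \<tau> = Poly_Mapping.map \<tau>"

definition central_morphism :: "('h::ring_1 \<Rightarrow> 'k::comm_ring_1) \<Rightarrow> bool" where
  "central_morphism \<tau> \<longleftrightarrow>
     (\<forall>x y. \<tau> (x + y) = \<tau> x + \<tau> y) \<and> (\<forall>x y. \<tau> (x * y) = \<tau> (y * x))"

text \<open>
  The element \<open>1/n\<close> of a ring in which \<open>n\<close> is invertible. Since \<open>of_nat n\<close> is central,
  a one-sided inverse is two-sided and unique.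
\<close>

definition inv_of_nat :: "nat \<Rightarrow> 'r::ring_1" where
  "inv_of_nat n = (THE x. of_nat n * x = 1)"

lemma inv_of_nat_eqI:
  assumes "of_nat n * (x :: 'r::ring_1) = 1"
  shows "inv_of_nat n = x"
  unfolding inv_of_nat_def
proof (rule the_equality)
  fix y :: 'r assume y: "of_nat n * y = 1"
  have "y = y * (of_nat n * x)" using assms by simp
  also have "\<dots> = (y * of_nat n) * x" by (simp only: mult.assoc)
  also have "\<dots> = of_nat n * y * x" by (simp only: mult_of_nat_commute)
  finally show "y = x" using y by simp
qed fact

text \<open>
  A unital additive map sends \<open>1/n\<close> to \<open>1/n\<close>; in particular \<open>n\<close> is then invertible in the
  target as soon as it is invertible in the source.
\<close>

lemma inv_of_nat_image:
  fixes \<tau> :: "'h::ring_1 \<Rightarrow> 'k::comm_ring_1"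
  assumes "central_morphism \<tau>" and "\<tau> 1 = 1" and "of_nat n * (x::'h) = 1"
  shows "of_nat n * \<tau> x = 1" and "inv_of_nat n = \<tau> x"
proof -
  have add: "\<tau> (u + w) = \<tau> u + \<tau> w" for u w
    using assms(1) by (simp add: central_morphism_def)
  have "\<tau> 0 + \<tau> 0 = \<tau> 0" using add [of 0 0] by simp
  then have "\<tau> 0 = 0" by simp
  then have "\<tau> (of_nat n * x) = of_nat n * \<tau> x"
    by (induction n) (simp_all add: add distrib_right)
  then show *: "of_nat n * \<tau> x = 1" using assms by simp
  from inv_of_nat_eqI [OF *] show "inv_of_nat n = \<tau> x" .
qed

section \<open>Cyclic sequences and directed cycles\<close>

definition cyclic_prod :: "('a \<Rightarrow> 'a \<Rightarrow> 'r::monoid_mult) \<Rightarrow> 'a list \<Rightarrow> 'r" where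
  "cyclic_prod f xs = prod_list (map2 f xs (rotate1 xs))"

definition cycle_edges :: "'a list \<Rightarrow> ('a \<times> 'a) set" where
  "cycle_edges xs = set (zip xs (rotate1 xs))"

text \<open>
  A directed cycle is identified with its set of edges; this set determines the list of
  visited vertices up to rotation. Loops are cycles of length 1 and pairs of opposite edges
  are cycles of length 2.
\<close>

definition directed_cycles :: "('a \<times> 'a) set \<Rightarrow> ('a \<times> 'a) set set" where
  "directed_cycles F = {c. c \<subseteq> F \<and> (\<exists>xs. xs \<noteq> [] \<and> distinct xs \<and> c = cycle_edges xs)}"

text \<open>
  The vertices visited by a cycle, in cyclic order, from an arbitrary starting point. It is
  used below only through quantities that do not depend on the starting point.
\<close>

definition cycle_vertices :: "('a \<times> 'a) set \<Rightarrow> 'a list" where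
  "cycle_vertices c = (SOME xs. xs \<noteq> [] \<and> distinct xs \<and> c = cycle_edges xs)"

text \<open>
  The \<open>\<tau>\<close>-determinant of the \<open>p \<times> p\<close> matrix with entries \<open>M i j\<close>, \<open>i, j < p\<close>. The cycles of
  a permutation, fixed points included, are the directed cycles of its graph.
\<close>

definition det_tau ::
  "('h::ring_1 \<Rightarrow> 'k::comm_ring_1) \<Rightarrow> nat \<Rightarrow> (nat \<Rightarrow> nat \<Rightarrow> ('i, 'h) mvpoly) \<Rightarrow> ('i, 'k) mvpoly"
where
  "det_tau \<tau> p M =
     (\<Sum>\<pi> | \<pi> permutes {..<p}.
        of_int (sign \<pi>) *
        (\<Prod>c \<in> directed_cycles ((\<lambda>i. (i, \<pi> i)) ` {..<p}).
           coeffwise \<tau> (cyclic_prod M (cycle_vertices c))))"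

section \<open>The skeleton of the simplex\<close>

definition skeleton :: "nat \<Rightarrow> nat \<Rightarrow> nat set set" where
  "skeleton v d = {\<sigma>. \<sigma> \<subseteq> {1..v} \<and> \<sigma> \<noteq> {} \<and> card \<sigma> \<le> d + 1}"

definition cells :: "nat \<Rightarrow> nat \<Rightarrow> nat \<Rightarrow> nat set set" where
  "cells v d q = {\<sigma> \<in> skeleton v d. card \<sigma> = q + 1}"

definition edges :: "nat \<Rightarrow> nat \<Rightarrow> (nat set \<times> nat set) set" where
  "edges v d = {(\<sigma>, \<sigma>'). \<sigma> \<in> cells v d (d - 1) \<and> \<sigma>' \<in> cells v d (d - 1) \<and>
                          \<sigma> \<union> \<sigma>' \<in> cells v d d}"

text \<open>
  Simplicial chains are written in the basis of the cells \<open>[x\<^sub>0 < \<dots> < x\<^sub>q]\<close> with vertices in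
  increasing order. The face of \<open>\<rho>\<close> opposite to \<open>x\<close> has the sign \<open>(-1) ^ i\<close>, where \<open>i\<close> is
  the position of \<open>x\<close> in \<open>\<rho>\<close>, that is, the number of smaller vertices.
\<close>

definition boundary :: "nat set \<Rightarrow> nat set \<Rightarrow>\<^sub>0 int" where
  "boundary \<rho> = (\<Sum>x\<in>\<rho>. Poly_Mapping.single (\<rho> - {x}) ((-1) ^ card {y \<in> \<rho>. y < x}))"

text \<open>
  An orientation chooses, for each cell \<open>\<sigma>\<close>, one of the two opposite oriented cells: the
  oriented cell is \<open>\<omega> \<sigma>\<close> times the cell with vertices in increasing order.
\<close>

definition is_orientation :: "nat \<Rightarrow> nat \<Rightarrow> (nat set \<Rightarrow> int) \<Rightarrow> bool" where
  "is_orientation v d \<omega> \<longleftrightarrow> (\<forall>\<sigma> \<in> skeleton v d. \<omega> \<sigma> \<in> {1, -1})"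

text \<open>
  The coefficient of the oriented cell \<open>\<sigma>\<close> in the boundary of the oriented cell \<open>\<rho>\<close>. The
  coordinate along \<open>\<omega> \<sigma>\<close> times the basis cell is obtained by multiplying by
  \<open>inverse (\<omega> \<sigma>) = \<omega> \<sigma>\<close>.
\<close>

definition incidence :: "(nat set \<Rightarrow> int) \<Rightarrow> nat set \<Rightarrow> nat set \<Rightarrow> int" where
  "incidence \<omega> \<rho> \<sigma> = \<omega> \<sigma> * (\<omega> \<rho> * Poly_Mapping.lookup (boundary \<rho>) \<sigma>)"

definition eps :: "(nat set \<Rightarrow> int) \<Rightarrow> nat set \<Rightarrow> nat set \<Rightarrow> int" where
  "eps \<omega> \<sigma> \<sigma>' = - (incidence \<omega> (\<sigma> \<union> \<sigma>') \<sigma> * incidence \<omega> (\<sigma> \<union> \<sigma>') \<sigma>')"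

definition Delta ::
  "nat \<Rightarrow> nat \<Rightarrow> (nat set \<Rightarrow> int) \<Rightarrow> (nat set \<Rightarrow> nat set \<Rightarrow> 'h::ring_1) \<Rightarrow>
   nat set \<Rightarrow> nat set \<Rightarrow> (nat set \<times> nat set, 'h) mvpoly"
where
  "Delta v d \<omega> h \<sigma> \<sigma>' =
     (if (\<sigma>, \<sigma>') \<in> edges v d then
        - (of_int (eps \<omega> \<sigma> \<sigma>') * Const (h \<sigma> \<sigma>') * Var (\<sigma>, \<sigma>'))
      else if \<sigma> = \<sigma>' then
        Const (inv_of_nat d) *
        (\<Sum>\<sigma>'' | \<sigma>'' \<in> cells v d (d - 1) - {\<sigma>} \<and> (\<sigma>, \<sigma>'') \<in> edges v d. Var (\<sigma>, \<sigma>''))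
      else 0)"

text \<open>
  Cycle-and-well-rooted spanning forests with set of non-well vertices \<open>U\<close>.
\<close>

definition forests :: "('a \<times> 'a) set \<Rightarrow> 'a set \<Rightarrow> ('a \<times> 'a) set set" where
  "forests E U = {F. F \<subseteq> E \<and> card F = card U \<and> (\<forall>\<sigma> \<in> U. \<exists>!e. e \<in> F \<and> fst e = \<sigma>)}"

end

theory Submission
  imports Defs "HOL-Combinatorics.Cycles"
begin

text \<open>
  Both sides are expanded until they become sums over matching sets of configurations.

  On the left-hand side, a permutation \<open>\<pi>\<close> of the non-well cells \<open>U\<close> contributes a product
  over its cycles. Distributing the sign over the cycles, a non-trivial cycle \<open>c\<close> of length
  \<open>l\<close> has sign \<open>(- 1) ^ (l - 1)\<close>, while its \<open>l\<close> entries \<open>- \<epsilon> h a\<close> carry \<open>(- 1) ^ l\<close>. The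
  contribution is thus \<open>- \<epsilon>\<^sub>c \<tau>(h\<^sub>c)\<close> times the product of the variables on the edges of \<open>c\<close>,
  or zero if \<open>c\<close> uses a pair of non-adjacent cells. A fixed point contributes the diagonal
  entry, that is, a sum over all edges leaving it, each with weight \<open>a\<^sub>e / d\<close>. Hence the
  left-hand side is a sum over pairs \<open>(\<pi>, G)\<close>, where \<open>G\<close> selects one outgoing edge at each
  fixed point.

  On the right-hand side, multiplying out \<open>1 - d ^ l \<epsilon>\<^sub>c \<tau>(h\<^sub>c)\<close> over the cycles of a forest \<open>F\<close>
  gives a sum over pairs \<open>(F, A)\<close>, where \<open>A\<close> is a set of cycles of \<open>F\<close>. A forest has one edge
  out of each element of \<open>U\<close>, so its cycles are vertex disjoint. To \<open>(F, A)\<close> corresponds the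
  permutation \<open>\<pi>\<close> that rotates along the cycles of \<open>A\<close> and fixes everything else, together with
  the edges \<open>G\<close> of \<open>F\<close> outside \<open>A\<close>; conversely, \<open>F\<close> is the union of \<open>G\<close> and the non-trivial
  cycles of \<open>\<pi>\<close>. No cycle in \<open>A\<close> is lost this way because \<open>(\<sigma>, \<sigma>)\<close> is never an edge. This
  bijection is the content of \<open>cycle_forest_expansion\<close>. The factors of \<open>d\<close> agree: of the \<open>m\<close>
  factors \<open>1 / d\<close> in front, those at vertices of \<open>A\<close> cancel against \<open>d ^ l\<close>, and one remains
  for each fixed point of \<open>\<pi>\<close>.

  Noncommutativity enters only through \<open>\<tau>\<close> of a product along a cycle, which by centrality
  depends on the cycle and not on its starting point
  (\<open>central_morphism_cyclic_prod_cong\<close>). The sign formula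
  \<open>sign_eq_prod_directed_cycles\<close> comes from decomposing a permutation into disjoint cycles.
\<close>

section \<open>Cycles of functional graphs\<close>

lemma cycle_edges_conv_nth:
  "cycle_edges xs = (\<lambda>i. (xs ! i, xs ! (Suc i mod length xs))) ` {..<length xs}"
  by (auto simp: cycle_edges_def set_zip nth_rotate1 image_iff)

lemma cycle_edges_map: "cycle_edges (map g xs) = map_prod g g ` cycle_edges xs"
  by (simp add: cycle_edges_def rotate1_map zip_map_map map_prod_def)

lemma fst_cycle_edges: "fst ` cycle_edges xs = set xs"
  by (simp add: cycle_edges_def flip: set_map)

lemma snd_cycle_edges: "snd ` cycle_edges xs = set xs"
  by (simp add: cycle_edges_def flip: set_map)

lemma single_valued_cycle_edges:
  assumes "distinct xs"
  shows "single_valued (cycle_edges xs)"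
proof (rule single_valuedI)
  fix x y z assume "(x, y) \<in> cycle_edges xs" "(x, z) \<in> cycle_edges xs"
  then obtain i j where "i < length xs" "x = xs ! i" "y = xs ! (Suc i mod length xs)"
    "j < length xs" "x = xs ! j" "z = xs ! (Suc j mod length xs)"
    by (auto simp: cycle_edges_conv_nth)
  then show "y = z" using assms by (metis nth_eq_iff_index_eq)
qed

lemma card_cycle_edges: "distinct xs \<Longrightarrow> card (cycle_edges xs) = length xs"
  by (simp add: cycle_edges_def distinct_zipI1 distinct_card)

lemma zip_rotate1_rotate1: "length xs = length ys \<Longrightarrow> zip (rotate1 xs) (rotate1 ys) = rotate1 (zip xs ys)"
  by (cases xs; cases ys) simp_all

lemma cycle_edges_rotate1: "cycle_edges (rotate1 xs) = cycle_edges xs"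
  by (simp add: cycle_edges_def zip_rotate1_rotate1)

lemma cycle_edges_rotate: "cycle_edges (rotate n xs) = cycle_edges xs"
  by (induction n) (simp_all add: cycle_edges_rotate1)

text \<open>
  The edge set of a cycle forgets only the starting point: once the starting points are made
  to agree, both lists follow the unique edge out of each vertex.
\<close>

lemma cycle_edges_eq_imp_rotate:
  assumes "distinct xs" "distinct ys" "xs \<noteq> []" "cycle_edges xs = cycle_edges ys"
  shows "\<exists>n. ys = rotate n xs"
proof -
  have set_eq: "set xs = set ys" using assms(4) by (metis fst_cycle_edges)
  then have ne: "ys \<noteq> []" using assms(3) by auto
  then have "ys ! 0 \<in> set xs" using set_eq by simp
  then obtain n where n: "n < length xs" "xs ! n = ys ! 0" by (metis in_set_conv_nth)
  \<comment> \<open>\<open>zs\<close> is the rotation of \<open>xs\<close> that starts where \<open>ys\<close> starts.\<close>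
  define zs where "zs = rotate n xs"
  have zs: "distinct zs" "cycle_edges zs = cycle_edges ys" "length zs = length ys"
    using assms set_eq by (simp_all add: zs_def cycle_edges_rotate) (metis distinct_card)
  have "zs ! i = ys ! i" if "i < length ys" for i using that
  proof (induction i)
    case 0
    then show ?case using n assms(3) by (simp add: zs_def nth_rotate)
  next
    case (Suc i)
    have "(ls ! i, ls ! Suc i) \<in> cycle_edges ls" if "length ls = length ys" for ls :: "'a list"
      using Suc.prems that by (auto simp: cycle_edges_conv_nth image_iff intro!: bexI[of _ i])
    from this[of zs] this[of ys]
    have "(zs ! i, zs ! Suc i) \<in> cycle_edges ys" "(ys ! i, ys ! Suc i) \<in> cycle_edges ys"
      using zs by simp_all
    with Suc single_valued_cycle_edges[OF assms(2)] show ?case by (auto dest: single_valuedD)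
  qed
  then have "zs = ys" using zs(3) by (auto intro: nth_equalityI)
  then show ?thesis by (auto simp: zs_def)
qed

lemma directed_cyclesE:
  assumes "c \<in> directed_cycles F"
  obtains xs where "xs \<noteq> []" "distinct xs" "c = cycle_edges xs" "c \<subseteq> F"
  using assms by (auto simp: directed_cycles_def)

lemma cycle_vertices_props:
  assumes "c \<in> directed_cycles F"
  shows "cycle_vertices c \<noteq> []" "distinct (cycle_vertices c)" "cycle_edges (cycle_vertices c) = c"
proof -
  have "\<exists>xs. xs \<noteq> [] \<and> distinct xs \<and> c = cycle_edges xs"
    using assms by (auto simp: directed_cycles_def)
  from someI_ex[OF this]
  show "cycle_vertices c \<noteq> []" "distinct (cycle_vertices c)" "cycle_edges (cycle_vertices c) = c"
    by (simp_all add: cycle_vertices_def)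
qed

lemma length_cycle_vertices: "c \<in> directed_cycles F \<Longrightarrow> length (cycle_vertices c) = card c"
  using cycle_vertices_props card_cycle_edges by metis

lemma directed_cycles_mono: "F \<subseteq> G \<Longrightarrow> directed_cycles F \<subseteq> directed_cycles G"
  by (auto simp: directed_cycles_def)

lemma finite_directed_cycles: "finite F \<Longrightarrow> finite (directed_cycles F)"
  by (rule finite_subset[of _ "Pow F"]) (auto simp: directed_cycles_def)

lemma Union_directed_cycles_subset: "\<Union> (directed_cycles F) \<subseteq> F"
  by (auto simp: directed_cycles_def)

lemma directed_cycle_subset_restrict:
  "c \<in> directed_cycles F \<Longrightarrow> c \<subseteq> G \<Longrightarrow> c \<in> directed_cycles G"
  by (auto simp: directed_cycles_def)

lemma directed_cycle_source_eq_target: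
  "c \<in> directed_cycles F \<Longrightarrow> fst ` c = snd ` c"
  by (elim directed_cyclesE) (simp add: fst_cycle_edges snd_cycle_edges)

text \<open>
  In a functional graph there is only one way to continue a walk. A cycle that meets \<open>c'\<close>
  therefore runs along \<open>c'\<close> forever, and since it comes back to each of its own vertices it is
  contained in \<open>c'\<close>.
\<close>

lemma directed_cycle_subset_of_meet:
  assumes F: "single_valued F" and c: "c \<in> directed_cycles F" and c': "c' \<in> directed_cycles F"
    and x: "x \<in> fst ` c" "x \<in> fst ` c'"
  shows "c \<subseteq> c'"
proof -
  obtain xs where xs: "xs \<noteq> []" "distinct xs" "c = cycle_edges xs" "c \<subseteq> F"
    using c by (rule directed_cyclesE)
  have sub': "c' \<subseteq> F" using c' by (auto simp: directed_cycles_def)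
  have step: "(a, b) \<in> c'" if "(a, b) \<in> F" "a \<in> fst ` c'" for a b
    proof -
    obtain b' where "(a, b') \<in> c'" using \<open>a \<in> fst ` c'\<close> by force
    moreover from this have "b' = b" using that(1) sub' single_valuedD[OF F] by blast
    ultimately show ?thesis by simp
  qed
  obtain k where k: "k < length xs" "x = xs ! k"
    using x(1) xs(3) fst_cycle_edges by (metis in_set_conv_nth)
  let ?n = "length xs"
  have edge: "(xs ! (i mod ?n), xs ! (Suc i mod ?n)) \<in> c" for i
    unfolding xs(3) cycle_edges_conv_nth image_iff
    by (rule bexI[of _ "i mod ?n"]) (use xs(1) in \<open>auto simp: mod_Suc_eq\<close>)
  \<comment> \<open>Starting at the common vertex, every further vertex of the cycle stays on \<open>c'\<close>.\<close>
  have walk: "xs ! ((k + i) mod ?n) \<in> fst ` c'" for i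
  proof (induction i)
    case 0
    then show ?case using k x by simp
  next
    case (Suc i)
    then have "(xs ! ((k + i) mod ?n), xs ! (Suc (k + i) mod ?n)) \<in> c'"
      using edge[of "k + i"] xs(4) by (intro step) auto
    then have "xs ! (Suc (k + i) mod ?n) \<in> snd ` c'" by force
    then show ?case using directed_cycle_source_eq_target[OF c'] by simp
  qed
  \<comment> \<open>The walk from position \<open>k\<close> reaches position \<open>i\<close> after \<open>i + n - k\<close> steps.\<close>
  have all: "xs ! i \<in> fst ` c'" if "i < ?n" for i
  proof -
    have "(k + (i + ?n - k)) mod ?n = i" using that k by simp
    then show ?thesis using walk[of "i + ?n - k"] by simp
  qed
  show ?thesis
  proof
    fix e assume e: "e \<in> c"
    then obtain a b where ab: "e = (a, b)" "(a, b) \<in> F" using xs(4) by (cases e) auto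
    have "a \<in> set xs" using e ab xs(3) fst_cycle_edges by force
    then have "a \<in> fst ` c'" using all by (metis in_set_conv_nth)
    then show "e \<in> c'" using step ab by simp
  qed
qed

text \<open>
  Hence the cycles of a functional graph are pairwise vertex disjoint.
\<close>

lemma directed_cycle_eq_of_meet:
  assumes "single_valued F" "c \<in> directed_cycles F" "c' \<in> directed_cycles F"
    and "x \<in> fst ` c" "x \<in> fst ` c'"
  shows "c = c'"
  using assms directed_cycle_subset_of_meet by (metis subset_antisym)

lemma directed_cycle_eq_of_common_edge:
  assumes "single_valued F" "c \<in> directed_cycles F" "c' \<in> directed_cycles F" "e \<in> c" "e \<in> c'"
  shows "c = c'"
  using assms directed_cycle_eq_of_meet[of F c c' "fst e"] by auto

lemma directed_cycle_nonempty: "c \<in> directed_cycles F \<Longrightarrow> c \<noteq> {}"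
  by (auto elim!: directed_cyclesE simp: cycle_edges_def)

text \<open>
  A selection of cycles of a functional graph can be recovered from the set of edges that it
  covers. This lets a subset of the cycles of a forest be encoded as a permutation.
\<close>

lemma directed_cycles_Union:
  assumes F: "single_valued F" and A: "A \<subseteq> directed_cycles F"
  shows "directed_cycles (\<Union>A) = A"
proof
  show "A \<subseteq> directed_cycles (\<Union>A)"
    using A by (auto intro: directed_cycle_subset_restrict)
  show "directed_cycles (\<Union>A) \<subseteq> A"
  proof
    fix c assume c: "c \<in> directed_cycles (\<Union>A)"
    have "\<Union>A \<subseteq> F" using A by (auto simp: directed_cycles_def)
    then have c': "c \<in> directed_cycles F" using c directed_cycles_mono by blast
    obtain e where e: "e \<in> c" using directed_cycle_nonempty[OF c] by auto
    have "c \<subseteq> \<Union>A" using c by (auto simp: directed_cycles_def)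
    then obtain c2 where "c2 \<in> A" "e \<in> c2" using e by blast
    then show "c \<in> A" using directed_cycle_eq_of_common_edge[OF F c' _ e] A by blast
  qed
qed

text \<open>
  Only injectivity on the set \<open>V\<close> of possible vertices is required, because the indexing of
  cells by positions in a list is injective only there.
\<close>

lemma directed_cycles_relabel:
  assumes g: "inj_on g V" and F: "F \<subseteq> V \<times> V"
  shows "directed_cycles (map_prod g g ` F) = (`) (map_prod g g) ` directed_cycles F"
proof (intro subset_antisym subsetI)
  fix c assume "c \<in> directed_cycles (map_prod g g ` F)"
  then obtain ys where ys: "ys \<noteq> []" "distinct ys" "c = cycle_edges ys" "c \<subseteq> map_prod g g ` F"
    by (rule directed_cyclesE)
  define f where "f = inv_into V g"
  have fg: "map_prod f f ` map_prod g g ` D = D" if "D \<subseteq> F" for D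
  proof -
    have "map_prod f f (map_prod g g e) = e" if "e \<in> D" for e
      using that \<open>D \<subseteq> F\<close> F g by (cases e) (auto simp: f_def inv_into_f_f)
    then show ?thesis by (force simp: image_iff)
  qed
  have sub: "set ys \<subseteq> g ` V" using ys(4) F unfolding fst_cycle_edges[symmetric] ys(3)[symmetric] by force
  have gf: "map g (map f ys) = ys"
    using sub by (auto simp: f_def f_inv_into_f intro!: map_idI)
  have "inj_on f (set ys)" using sub by (auto simp: f_def intro: inj_on_inv_into inj_on_subset)
  then have "distinct (map f ys)" using ys(2) by (simp add: distinct_map)
  moreover have "cycle_edges (map f ys) \<subseteq> F"
    using image_mono[OF ys(4), of "map_prod f f"] fg[OF subset_refl] ys(3)
    by (simp add: cycle_edges_map)
  ultimately have "cycle_edges (map f ys) \<in> directed_cycles F"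
    using ys(1) unfolding directed_cycles_def by (intro CollectI conjI exI[of _ "map f ys"]) simp_all
  moreover have "c = map_prod g g ` cycle_edges (map f ys)"
    using ys(3) gf by (metis cycle_edges_map)
  ultimately show "c \<in> (`) (map_prod g g) ` directed_cycles F" by blast
next
  fix c assume "c \<in> (`) (map_prod g g) ` directed_cycles F"
  then obtain xs where xs: "xs \<noteq> []" "distinct xs" "cycle_edges xs \<subseteq> F"
    "c = map_prod g g ` cycle_edges xs"
    by (auto simp: directed_cycles_def)
  have "set xs \<subseteq> V" using xs(3) F unfolding fst_cycle_edges[symmetric] by force
  then have "distinct (map g xs)" using xs g by (auto simp: distinct_map intro: inj_on_subset)
  moreover have "c = cycle_edges (map g xs)" using xs(4) by (simp add: cycle_edges_map)
  moreover have "c \<subseteq> map_prod g g ` F" using xs(3,4) by blast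
  ultimately show "c \<in> directed_cycles (map_prod g g ` F)"
    using xs(1) unfolding directed_cycles_def by (intro CollectI conjI exI[of _ "map g xs"]) simp_all
qed

section \<open>Cycles and sign of a permutation\<close>

abbreviation graph_on :: "'a set \<Rightarrow> ('a \<Rightarrow> 'a) \<Rightarrow> ('a \<times> 'a) set" where
  "graph_on U p \<equiv> (\<lambda>i. (i, p i)) ` U"

lemma single_valued_graph_on: "single_valued (graph_on U p)"
  by (auto simp: single_valued_def)

lemma graph_on_cycle_of_list:
  assumes "distinct cs"
  shows "graph_on (set cs) (cycle_of_list cs) = cycle_edges cs"
proof -
  have "rotate1 cs = map (cycle_of_list cs) cs"
    using cyclic_rotation[OF assms, of 1] by simp
  then have "cycle_edges cs = set (zip cs (map (cycle_of_list cs) cs))"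
    unfolding cycle_edges_def by metis
  then show ?thesis by (simp add: zip_map2 zip_same_conv_map image_image)
qed

lemma sign_cycle_of_list:
  assumes "distinct cs" "cs \<noteq> []"
  shows "sign (cycle_of_list cs) = - ((- 1) ^ length cs)"
  using assms
proof (induction cs rule: cycle_of_list.induct)
  case (1 i j cs)
  have "sign (cycle_of_list (i # j # cs)) = sign (transpose i j) * sign (cycle_of_list (j # cs))"
    by (simp add: sign_compose permutation_swap_id permutation_of_cycle)
  then show ?case using 1 by (simp add: sign_swap_id del: cycle_of_list.simps)
qed simp_all

text \<open>
  Induction on a decomposition into disjoint cycles. Adjoining one more cycle to a permutation
  adjoins its edge set to the graph; the enlarged graph is still functional, so it has no
  cycles besides the adjoined one and the old ones. The sign is multiplied by that of the new
  cycle, a product of \<open>l - 1\<close> transpositions if it has length \<open>l\<close>.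
\<close>

lemma cycle_decomp_graph:
  assumes "cycle_decomp I p"
  shows "finite I \<and> p permutes I \<and> \<Union> (directed_cycles (graph_on I p)) = graph_on I p \<and>
    sign p = (\<Prod>c\<in>directed_cycles (graph_on I p). - ((- 1) ^ card c))"
  using assms
proof induction
  case empty
  have "directed_cycles {} = ({} :: ('a \<times> 'a) set set)"
    by (auto simp: directed_cycles_def cycle_edges_def)
  then show ?case by (simp add: id_def)
next
  case (comp I p cs)
  let ?q = "cycle_of_list cs \<circ> p"
  have fin: "finite I" and p: "p permutes I" using comp.IH by auto
  have q: "?q permutes (set cs \<union> I)"
    by (rule permutes_compose) (auto intro: permutes_subset[OF p] permutes_subset[OF cycle_permutes])
  have onI: "?q i = p i" if "i \<in> I" for i
    using that comp.hyps p by (auto simp: permutes_in_image intro!: id_outside_supp)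
  have oncs: "?q i = cycle_of_list cs i" if "i \<in> set cs" for i
    proof -
    from that have "i \<notin> I" using comp.hyps(3) by blast
    then show ?thesis by (simp add: permutes_not_in[OF p])
  qed
  have graph: "graph_on (set cs \<union> I) ?q = cycle_edges cs \<union> graph_on I p"
    unfolding image_Un graph_on_cycle_of_list[OF comp.hyps(2), symmetric]
    by (intro arg_cong2[of _ _ _ _ "(\<union>)"] image_cong) (use onI oncs in auto)
  show ?case
  proof (cases "cs = []")
    case True
    then show ?thesis using comp.IH by simp
  next
    case False
    let ?A = "insert (cycle_edges cs) (directed_cycles (graph_on I p))"
    have un: "\<Union> ?A = graph_on (set cs \<union> I) ?q" using comp.IH graph by simp
    have "?A \<subseteq> directed_cycles (graph_on (set cs \<union> I) ?q)"
      unfolding graph using directed_cycles_mono[of "graph_on I p" "cycle_edges cs \<union> graph_on I p"]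
        False comp.hyps(2) by (auto simp: directed_cycles_def)
    from directed_cycles_Union[OF single_valued_graph_on this]
    have dc: "directed_cycles (graph_on (set cs \<union> I) ?q) = ?A" by (simp only: un)
    have "cycle_edges cs \<notin> directed_cycles (graph_on I p)"
    proof
      assume "cycle_edges cs \<in> directed_cycles (graph_on I p)"
      then have "cycle_edges cs \<subseteq> graph_on I p" by (auto simp: directed_cycles_def)
      from image_mono[OF this, of fst] have "set cs \<subseteq> I"
        by (simp add: fst_cycle_edges image_image)
      then show False using comp.hyps(3) False by (cases cs) auto
    qed
    moreover have "sign ?q = sign (cycle_of_list cs) * sign p"
      using p fin by (intro sign_compose permutation_of_cycle) (auto simp: permutation_permutes)
    ultimately have "sign ?q = (\<Prod>c\<in>?A. - ((- 1) ^ card c))"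
      using comp.IH comp.hyps(2) False fin
      by (simp add: finite_directed_cycles sign_cycle_of_list card_cycle_edges)
    with fin q un dc show ?thesis by (metis finite_Un finite_set)
  qed
qed

lemma
  assumes "p permutes U" "finite U"
  shows Union_directed_cycles_permutation: "\<Union> (directed_cycles (graph_on U p)) = graph_on U p"
    and sign_eq_prod_directed_cycles:
      "sign p = (\<Prod>c\<in>directed_cycles (graph_on U p). - ((- 1) ^ card c))"
  using cycle_decomp_graph[OF cycle_decomposition[OF assms]] by auto

section \<open>Permutations as families of disjoint cycles\<close>

text \<open>
  The non-loop part of the graph of a permutation. Loops are set aside because adjacency
  has none: a fixed point contributes a choice of an arbitrary outgoing edge instead.
\<close>

definition moved :: "('a \<Rightarrow> 'a) \<Rightarrow> ('a \<times> 'a) set" where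
  "moved p = {(i, p i) |i. p i \<noteq> i}"

abbreviation fixed_in :: "'a set \<Rightarrow> ('a \<Rightarrow> 'a) \<Rightarrow> 'a set" where
  "fixed_in U p \<equiv> {i \<in> U. p i = i}"

lemma moved_subset_graph_on: "p permutes U \<Longrightarrow> moved p \<subseteq> graph_on U p"
  by (auto simp: moved_def permutes_def)

lemma loop_directed_cycle: "(i, i) \<in> F \<Longrightarrow> {(i, i)} \<in> directed_cycles F"
  unfolding directed_cycles_def by (auto simp: cycle_edges_def intro!: exI[of _ "[i]"])

lemma directed_cycle_with_loop:
  assumes "single_valued F" "c \<in> directed_cycles F" "(i, i) \<in> c"
  shows "c = {(i, i)}"
proof -
  have "(i, i) \<in> F" using assms(2,3) by (auto simp: directed_cycles_def)
  from directed_cycle_eq_of_common_edge[OF assms(1,2) loop_directed_cycle[OF this] assms(3)]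
  show ?thesis by simp
qed

lemma directed_cycles_permutation:
  assumes p: "p permutes U"
  shows "directed_cycles (graph_on U p) =
    directed_cycles (moved p) \<union> (\<lambda>i. {(i, i)}) ` fixed_in U p"
proof (intro subset_antisym subsetI)
  fix c assume c: "c \<in> directed_cycles (graph_on U p)"
  show "c \<in> directed_cycles (moved p) \<union> (\<lambda>i. {(i, i)}) ` fixed_in U p"
  proof (cases "\<exists>i. (i, i) \<in> c")
    case True
    then obtain i where "(i, i) \<in> c" by blast
    moreover from this c have "i \<in> fixed_in U p" by (auto simp: directed_cycles_def)
    ultimately show ?thesis
      using directed_cycle_with_loop[OF single_valued_graph_on c] by blast
  next
    case False
    then have "c \<subseteq> moved p" using c by (fastforce simp: directed_cycles_def moved_def)
    then show ?thesis using c directed_cycle_subset_restrict by blast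
  qed
next
  fix c assume "c \<in> directed_cycles (moved p) \<union> (\<lambda>i. {(i, i)}) ` fixed_in U p"
  then show "c \<in> directed_cycles (graph_on U p)"
    using directed_cycles_mono[OF moved_subset_graph_on[OF p]]
    by (auto intro!: loop_directed_cycle simp: image_iff)
qed

lemma Union_directed_cycles_moved:
  assumes p: "p permutes U" and U: "finite U"
  shows "\<Union> (directed_cycles (moved p)) = moved p"
proof (intro subset_antisym subsetI)
  fix e assume e: "e \<in> moved p"
  then have "e \<in> \<Union> (directed_cycles (graph_on U p))"
    using moved_subset_graph_on[OF p] unfolding Union_directed_cycles_permutation[OF p U] by blast
  then show "e \<in> \<Union> (directed_cycles (moved p))"
    using e unfolding directed_cycles_permutation[OF p] by (auto simp: moved_def)
qed (use Union_directed_cycles_subset in blast)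

text \<open>
  On unions of vertex disjoint cycles without loops this is inverse to \<open>moved\<close>. Vertices not
  on \<open>Q\<close> are fixed, which makes it a permutation of any larger vertex set.
\<close>

definition rotation_along :: "('a \<times> 'a) set \<Rightarrow> 'a \<Rightarrow> 'a" where
  "rotation_along Q i = (if i \<in> fst ` Q then snd (inv_into Q fst i) else i)"

lemma rotation_along_edge: "inj_on fst Q \<Longrightarrow> (i, j) \<in> Q \<Longrightarrow> rotation_along Q i = j"
  using inv_into_f_f[of fst Q "(i, j)"] by (force simp: rotation_along_def)

lemma inj_on_fst_moved: "inj_on fst (moved p)"
  by (auto simp: inj_on_def moved_def)

lemma rotation_along_moved: "rotation_along (moved p) = p"
proof
  fix i
  show "rotation_along (moved p) i = p i"
  proof (cases "p i = i")
    case True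
    then show ?thesis by (auto simp: rotation_along_def moved_def)
  next
    case False
    then show ?thesis
      by (intro rotation_along_edge inj_on_fst_moved) (auto simp: moved_def)
  qed
qed

lemma moved_rotation_along:
  assumes "inj_on fst Q" "\<And>i. (i, i) \<notin> Q"
  shows "moved (rotation_along Q) = Q"
proof (intro subset_antisym subsetI)
  fix e assume "e \<in> moved (rotation_along Q)"
  then obtain i where i: "e = (i, rotation_along Q i)" "rotation_along Q i \<noteq> i"
    by (auto simp: moved_def)
  then obtain j where "(i, j) \<in> Q" by (force simp: rotation_along_def split: if_splits)
  then show "e \<in> Q" using i rotation_along_edge[OF assms(1)] by simp
next
  fix e assume "e \<in> Q"
  then show "e \<in> moved (rotation_along Q)"
    using assms rotation_along_edge[OF assms(1)] by (cases e) (auto simp: moved_def)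
qed

text \<open>
  Sources and targets coincide, so the rotation maps the finite set of vertices of \<open>Q\<close> onto
  itself; surjectivity on a finite set gives injectivity.
\<close>

lemma rotation_along_permutes:
  assumes "finite Q" "inj_on fst Q" "fst ` Q = snd ` Q"
  shows "rotation_along Q permutes fst ` Q"
proof (rule bij_imp_permutes)
  have "rotation_along Q ` fst ` Q = (\<lambda>e. rotation_along Q (fst e)) ` Q" by (simp add: image_image)
  also have "\<dots> = snd ` Q"
    by (rule image_cong) (use rotation_along_edge[OF assms(2)] in auto)
  finally have im: "rotation_along Q ` fst ` Q = fst ` Q" using assms(3) by simp
  then show "bij_betw (rotation_along Q) (fst ` Q) (fst ` Q)"
    using assms(1) by (simp add: bij_betw_def eq_card_imp_inj_on)
qed (simp add: rotation_along_def)

section \<open>Expansion over forests\<close>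

text \<open>
  By counting: \<open>card F = card U\<close> and at least one edge out of each vertex of \<open>U\<close> leave no room
  for an edge that starts elsewhere. Finiteness of \<open>E\<close> matters, since an infinite \<open>F\<close> has
  cardinality \<open>0\<close>.
\<close>

lemma forests_iff:
  assumes "finite E" "finite U"
  shows "F \<in> forests E U \<longleftrightarrow> F \<subseteq> E \<and> bij_betw fst F U"
proof
  assume F: "F \<in> forests E U"
  then have sub: "F \<subseteq> E" and card: "card F = card U"
    and ex: "\<And>i. i \<in> U \<Longrightarrow> \<exists>e. e \<in> F \<and> fst e = i"
    unfolding forests_def by blast+
  have fin: "finite F" using sub assms(1) finite_subset by blast
  have U: "U \<subseteq> fst ` F" using ex by force
  have "card U \<le> card (fst ` F)" using U fin by (simp add: card_mono)
  moreover have "card (fst ` F) \<le> card F" using fin by (rule card_image_le)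
  ultimately have c: "card (fst ` F) = card F" using card by simp
  then have "fst ` F = U" using U fin card by (metis card_subset_eq finite_imageI)
  with c fin sub show "F \<subseteq> E \<and> bij_betw fst F U"
    by (simp add: bij_betw_def eq_card_imp_inj_on)
next
  assume "F \<subseteq> E \<and> bij_betw fst F U"
  then show "F \<in> forests E U"
    unfolding forests_def by (auto simp: bij_betw_same_card bij_betw_def inj_on_def; force)
qed

lemma finite_forests: "finite E \<Longrightarrow> finite (forests E U)"
  by (rule finite_subset[of _ "Pow E"]) (auto simp: forests_def)

text \<open>
  Expanding the product amounts to choosing one outgoing edge at each vertex, which is a forest.
\<close>

lemma prod_sum_outgoing_edges:
  fixes b :: "'a \<times> 'a \<Rightarrow> 'r::comm_semiring_1"
  assumes "finite E" "finite S"
  shows "(\<Prod>i\<in>S. \<Sum>e | e \<in> E \<and> fst e = i. b e) = (\<Sum>G\<in>forests E S. \<Prod>e\<in>G. b e)"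
proof -
  let ?B = "\<lambda>i. {e \<in> E. fst e = i}"
  have inj: "inj_on g S" if "g \<in> PiE S ?B" for g
    using that by (intro inj_on_inverseI[of _ fst]) auto
  have "(\<Prod>i\<in>S. \<Sum>e\<in>?B i. b e) = (\<Sum>g\<in>PiE S ?B. \<Prod>i\<in>S. b (g i))"
    using assms by (intro prod_sum_PiE) auto
  also have "\<dots> = (\<Sum>G\<in>forests E S. \<Prod>e\<in>G. b e)"
  proof (rule sum.reindex_bij_witness[where j = "\<lambda>g. g ` S"
        and i = "\<lambda>G. restrict (inv_into G fst) S"])
    fix g assume g: "g \<in> PiE S ?B"
    then have "(\<lambda>i. fst (g i)) ` S = (\<lambda>i. i) ` S" by (intro image_cong) auto
    then have "fst ` g ` S = S" by (simp add: image_image)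
    moreover have "inj_on fst (g ` S)" using PiE_mem[OF g] by (fastforce simp: inj_on_def)
    ultimately have bij: "bij_betw fst (g ` S) S" by (simp add: bij_betw_def)
    then show "g ` S \<in> forests E S" using g assms by (auto simp: forests_iff)
    have "inv_into (g ` S) fst i = g i" if "i \<in> S" for i
    proof -
      have "fst (g i) = i" using PiE_mem[OF g that] by simp
      then show ?thesis
        using that bij inv_into_f_f[of fst "g ` S" "g i"] by (simp add: bij_betw_def)
    qed
    then show "restrict (inv_into (g ` S) fst) S = g"
      using g by (intro extensionalityI[of _ S]) (auto simp: PiE_def)
    show "(\<Prod>e\<in>g ` S. b e) = (\<Prod>i\<in>S. b (g i))"
      using inj[OF g] by (simp add: prod.reindex)
  next
    fix G assume "G \<in> forests E S"
    then have G: "G \<subseteq> E" "inj_on fst G" "fst ` G = S"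
      using assms by (auto simp: forests_iff bij_betw_def)
    have "inv_into G fst i \<in> G" "fst (inv_into G fst i) = i" if "i \<in> S" for i
      using that G(3) by (auto intro: inv_into_into f_inv_into_f)
    then show "restrict (inv_into G fst) S \<in> PiE S ?B" using G(1) by auto
    have "restrict (inv_into G fst) S ` S = inv_into G fst ` fst ` G" using G(3) by simp
    also have "\<dots> = G" using G(2) by (rule inv_into_image_cancel) simp
    finally show "restrict (inv_into G fst) S ` S = G" .
  qed
  finally show ?thesis .
qed

text \<open>
  The combinatorial core, with edge weights \<open>b\<close> and cycle weights \<open>w\<close>. Expanding everything, the
  left-hand side becomes a sum over pairs \<open>(p, G)\<close> of a permutation whose non-trivial cycles
  lie in \<open>E\<close> and a choice \<open>G\<close> of an outgoing edge at each fixed point; the right-hand side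
  becomes a sum over pairs \<open>(F, A)\<close> of a forest and a subset \<open>A\<close> of its cycles. The two sets of
  pairs correspond under \<open>F = moved p \<union> G\<close>, where \<open>A\<close> consists of the non-trivial cycles of \<open>p\<close>.
  The cycles that happen to be created by \<open>G\<close> are cycles of \<open>F\<close> outside \<open>A\<close>, and account for the
  summand \<open>1\<close> in the factors \<open>1 + w c\<close>.
\<close>

lemma cycle_forest_expansion:
  fixes b :: "'a \<times> 'a \<Rightarrow> 'r::comm_semiring_1" and w X :: "('a \<times> 'a) set \<Rightarrow> 'r"
  assumes E: "finite E" and U: "finite U" and no_loop: "\<And>i. (i, i) \<notin> E"
    and X_loop: "\<And>i. i \<in> U \<Longrightarrow> X {(i, i)} = (\<Sum>e | e \<in> E \<and> fst e = i. b e)"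
    and X_cycle: "\<And>c. c \<in> directed_cycles E \<Longrightarrow> X c = w c * (\<Prod>e\<in>c. b e)"
    and X_zero: "\<And>c. c \<in> directed_cycles (U \<times> U) \<Longrightarrow> \<forall>i. (i, i) \<notin> c \<Longrightarrow> \<not> c \<subseteq> E \<Longrightarrow> X c = 0"
  shows "(\<Sum>p | p permutes U. \<Prod>c\<in>directed_cycles (graph_on U p). X c) =
    (\<Sum>F\<in>forests E U. (\<Prod>e\<in>F. b e) * (\<Prod>c\<in>directed_cycles F. 1 + w c))"
proof -
  let ?good = "{p. p permutes U \<and> moved p \<subseteq> E}"
  let ?term = "\<lambda>P G. (\<Prod>e\<in>P \<union> G. b e) * (\<Prod>c\<in>directed_cycles P. w c)"
  have fin_mv: "finite (moved p)" if "p permutes U" for p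
    using finite_subset[OF moved_subset_graph_on[OF that]] U by simp
  have disj_src: "fst ` moved p \<inter> fixed_in U p = {}" for p
    by (auto simp: moved_def)
  have src_mv: "fst ` moved p = {i. p i \<noteq> i}" for p
    by (auto simp: moved_def image_iff)
  have perm_term: "(\<Prod>c\<in>directed_cycles (graph_on U p). X c) =
      (\<Prod>c\<in>directed_cycles (moved p). X c) * (\<Sum>G\<in>forests E (fixed_in U p). \<Prod>e\<in>G. b e)"
    if p: "p permutes U" for p
  proof -
    have "(\<Prod>c\<in>directed_cycles (graph_on U p). X c) =
        (\<Prod>c\<in>directed_cycles (moved p). X c) * (\<Prod>c\<in>(\<lambda>i. {(i, i)}) ` fixed_in U p. X c)"
      unfolding directed_cycles_permutation[OF p]
      using U finite_directed_cycles[OF fin_mv[OF p]]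
      by (intro prod.union_disjoint) (auto simp: directed_cycles_def moved_def)
    also have "(\<Prod>c\<in>(\<lambda>i. {(i, i)}) ` fixed_in U p. X c) =
        (\<Prod>i\<in>fixed_in U p. \<Sum>e | e \<in> E \<and> fst e = i. b e)"
      by (subst prod.reindex) (auto simp: inj_on_def X_loop intro!: prod.cong)
    also have "\<dots> = (\<Sum>G\<in>forests E (fixed_in U p). \<Prod>e\<in>G. b e)"
      using E U by (intro prod_sum_outgoing_edges) auto
    finally show ?thesis .
  qed
  have good_term: "(\<Prod>c\<in>directed_cycles (graph_on U p). X c) =
      (\<Sum>G\<in>forests E (fixed_in U p). ?term (moved p) G)" if "p \<in> ?good" for p
  proof -
    from that have p: "p permutes U" and mv: "moved p \<subseteq> E" by auto
    have "(\<Prod>c\<in>directed_cycles (moved p). X c) =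
        (\<Prod>c\<in>directed_cycles (moved p). w c * (\<Prod>e\<in>c. b e))"
      using directed_cycles_mono[OF mv] by (intro prod.cong X_cycle) auto
    also have "\<dots> = (\<Prod>c\<in>directed_cycles (moved p). w c) *
        (\<Prod>e\<in>\<Union> (directed_cycles (moved p)). b e)"
    proof -
      have "single_valued (moved p)" by (auto simp: single_valued_def moved_def)
      then have "\<forall>c\<in>directed_cycles (moved p). \<forall>c'\<in>directed_cycles (moved p).
          c \<noteq> c' \<longrightarrow> c \<inter> c' = {}"
        using directed_cycle_eq_of_common_edge by blast
      moreover have "\<forall>c\<in>directed_cycles (moved p). finite c"
        using fin_mv[OF p] finite_subset by (auto simp: directed_cycles_def)
      ultimately show ?thesis
        by (simp add: prod.distrib prod.Union_disjoint)
    qed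
    finally have cyc: "(\<Prod>c\<in>directed_cycles (moved p). X c) =
        (\<Prod>c\<in>directed_cycles (moved p). w c) * (\<Prod>e\<in>moved p. b e)"
      by (simp add: Union_directed_cycles_moved[OF p U])
    have union: "(\<Prod>e\<in>moved p \<union> G. b e) = (\<Prod>e\<in>moved p. b e) * (\<Prod>e\<in>G. b e)"
      if "G \<in> forests E (fixed_in U p)" for G
    proof (rule prod.union_disjoint)
      have "G \<subseteq> E" "fst ` G = fixed_in U p"
        using that E U by (auto simp: forests_iff bij_betw_def)
      then show "finite G" "moved p \<inter> G = {}"
        using E disj_src[of p] by (auto intro: finite_subset)
    qed (rule fin_mv[OF p])
    show ?thesis
      unfolding perm_term[OF p] cyc sum_distrib_left
      by (rule sum.cong) (simp_all add: union mult_ac)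
  qed
  \<comment> \<open>A permutation with a non-trivial cycle leaving \<open>E\<close> picks a zero entry.\<close>
  have bad_term: "(\<Prod>c\<in>directed_cycles (graph_on U p). X c) = 0"
    if p: "p permutes U" and bad: "\<not> moved p \<subseteq> E" for p
  proof -
    obtain e where e: "e \<in> moved p" "e \<notin> E" using bad by blast
    then obtain c where c: "c \<in> directed_cycles (moved p)" "e \<in> c"
      using Union_directed_cycles_moved[OF p U] by blast
    have "moved p \<subseteq> U \<times> U"
      using moved_subset_graph_on[OF p] p by (auto simp: permutes_in_image)
    then have "X c = 0"
    proof (intro X_zero)
      show "c \<in> directed_cycles (U \<times> U)"
        using directed_cycles_mono[OF \<open>moved p \<subseteq> U \<times> U\<close>] c(1) by blast
      show "\<forall>i. (i, i) \<notin> c" using c(1) Union_directed_cycles_subset[of "moved p"] by (auto simp: moved_def)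
      show "\<not> c \<subseteq> E" using c(2) e(2) by blast
    qed
    then have "(\<Prod>c\<in>directed_cycles (moved p). X c) = 0"
      using c finite_directed_cycles[OF fin_mv[OF p]] by (intro prod_zero) auto
    then show ?thesis by (simp add: perm_term[OF p])
  qed
  have "(\<Sum>p | p permutes U. \<Prod>c\<in>directed_cycles (graph_on U p). X c) =
      (\<Sum>p\<in>?good. \<Prod>c\<in>directed_cycles (graph_on U p). X c)"
    by (rule sum.mono_neutral_right) (use U finite_permutations bad_term in auto)
  also have "\<dots> = (\<Sum>p\<in>?good. \<Sum>G\<in>forests E (fixed_in U p). ?term (moved p) G)"
    by (rule sum.cong[OF refl good_term])
  also have "\<dots> = (\<Sum>(p, G)\<in>(SIGMA p:?good. forests E (fixed_in U p)). ?term (moved p) G)"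
    using U finite_permutations[OF U] finite_forests[OF E] by (intro sum.Sigma) auto
  also have "\<dots> = (\<Sum>(F, A)\<in>(SIGMA F:forests E U. Pow (directed_cycles F)).
      (\<Prod>e\<in>F. b e) * (\<Prod>c\<in>A. w c))"
  proof (rule sum.reindex_bij_witness[where
        j = "\<lambda>(p, G). (moved p \<union> G, directed_cycles (moved p))" and
        i = "\<lambda>(F, A). (rotation_along (\<Union>A), F - \<Union>A)"])
    fix x assume "x \<in> (SIGMA p:?good. forests E (fixed_in U p))"
    then obtain p G where x: "x = (p, G)" and p: "p permutes U" and mv: "moved p \<subseteq> E"
      and "G \<in> forests E (fixed_in U p)" by (cases x) auto
    then have G: "G \<subseteq> E" "inj_on fst G" "fst ` G = fixed_in U p"
      using E U by (auto simp: forests_iff bij_betw_def)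
    have disj: "moved p \<inter> G = {}" using G(3) disj_src[of p] by blast
    have "fst ` (moved p \<union> G) = U"
      using p unfolding image_Un G(3) src_mv by (auto simp: permutes_def)
    moreover have "inj_on fst (moved p \<union> G)"
      using G(2,3) inj_on_fst_moved[of p] disj_src[of p] unfolding inj_on_Un by blast
    ultimately have "moved p \<union> G \<in> forests E U"
      using mv G(1) E U by (simp add: forests_iff bij_betw_def)
    then show "(case x of (p, G) \<Rightarrow> (moved p \<union> G, directed_cycles (moved p)))
        \<in> (SIGMA F:forests E U. Pow (directed_cycles F))"
      using directed_cycles_mono[of "moved p" "moved p \<union> G"] by (simp add: x)
    show "(case (case x of (p, G) \<Rightarrow> (moved p \<union> G, directed_cycles (moved p))) of
        (F, A) \<Rightarrow> (rotation_along (\<Union>A), F - \<Union>A)) = x"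
      using disj by (simp add: x Union_directed_cycles_moved[OF p U] rotation_along_moved Un_Diff Diff_triv Int_commute)
    show "(case (case x of (p, G) \<Rightarrow> (moved p \<union> G, directed_cycles (moved p))) of
        (F, A) \<Rightarrow> (\<Prod>e\<in>F. b e) * (\<Prod>c\<in>A. w c)) = (case x of (p, G) \<Rightarrow> ?term (moved p) G)"
      by (simp add: x)
  next
    fix y assume "y \<in> (SIGMA F:forests E U. Pow (directed_cycles F))"
    then obtain F A where y: "y = (F, A)" and F: "F \<in> forests E U" and A: "A \<subseteq> directed_cycles F"
      by (cases y) auto
    from F have F: "F \<subseteq> E" "inj_on fst F" "fst ` F = U"
      using E U by (auto simp: forests_iff bij_betw_def)
    have sv: "single_valued F" using inj_onD[OF F(2)] by (intro single_valuedI) force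
    let ?Q = "\<Union>A"
    have Q: "?Q \<subseteq> F" using A Union_directed_cycles_subset by blast
    have inj: "inj_on fst ?Q" using F(2) Q by (rule inj_on_subset)
    have finQ: "finite ?Q" using Q F(1) E by (meson finite_subset)
    have "fst ` c = snd ` c" if "c \<in> A" for c
      using directed_cycle_source_eq_target A that by blast
    then have "fst ` ?Q = snd ` ?Q" unfolding image_Union by simp
    from rotation_along_permutes[OF finQ inj this]
    have perm: "rotation_along ?Q permutes U"
      by (rule permutes_subset) (use Q F(3) in blast)
    have mv: "moved (rotation_along ?Q) = ?Q"
      using inj Q F(1) no_loop by (intro moved_rotation_along) auto
    \<comment> \<open>The remaining edges of \<open>F\<close> start exactly at the fixed points of the rotation.\<close>
    have fix_eq: "fixed_in U (rotation_along ?Q) = U - fst ` ?Q"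
      using src_mv[of "rotation_along ?Q"] unfolding mv by auto
    have "fst ` (F - ?Q) = U - fst ` ?Q"
      using inj_on_image_set_diff[OF F(2) Diff_subset Q] F(3) by simp
    moreover have "inj_on fst (F - ?Q)" using F(2) by (rule inj_on_diff)
    ultimately have "F - ?Q \<in> forests E (fixed_in U (rotation_along ?Q))"
      using E U F(1) unfolding fix_eq by (subst forests_iff) (auto simp: bij_betw_def)
    then show "(case y of (F, A) \<Rightarrow> (rotation_along (\<Union>A), F - \<Union>A))
        \<in> (SIGMA p:?good. forests E (fixed_in U p))"
      using perm mv Q F(1) by (simp add: y)
    show "(case (case y of (F, A) \<Rightarrow> (rotation_along (\<Union>A), F - \<Union>A)) of
        (p, G) \<Rightarrow> (moved p \<union> G, directed_cycles (moved p))) = y"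
      using Q directed_cycles_Union[OF sv A] by (auto simp: y mv)
  qed
  also have "\<dots> = (\<Sum>F\<in>forests E U. \<Sum>A\<in>Pow (directed_cycles F). (\<Prod>e\<in>F. b e) * (\<Prod>c\<in>A. w c))"
    using finite_forests[OF E] E
    by (intro sum.Sigma[symmetric] ballI)
      (auto simp: forests_def intro!: finite_directed_cycles finite_subset[of _ E])
  also have "\<dots> = (\<Sum>F\<in>forests E U. (\<Prod>e\<in>F. b e) * (\<Prod>c\<in>directed_cycles F. 1 + w c))"
  proof (rule sum.cong[OF refl])
    fix F assume "F \<in> forests E U"
    then have "finite (directed_cycles F)"
      using E by (auto simp: forests_def intro: finite_directed_cycles finite_subset)
    from prod_add[OF this, of w "\<lambda>_. 1"]
    show "(\<Sum>A\<in>Pow (directed_cycles F). (\<Prod>e\<in>F. b e) * (\<Prod>c\<in>A. w c)) =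
        (\<Prod>e\<in>F. b e) * (\<Prod>c\<in>directed_cycles F. 1 + w c)"
      by (simp add: add.commute flip: sum_distrib_left)
  qed
  finally show ?thesis .
qed

section \<open>Central morphisms and cyclic products\<close>

lemma cyclic_prod_conv_edges:
  "cyclic_prod f xs = prod_list (map (\<lambda>e. f (fst e) (snd e)) (zip xs (rotate1 xs)))"
  by (simp add: cyclic_prod_def case_prod_unfold)

lemma cyclic_prod_map: "cyclic_prod f (map g xs) = cyclic_prod (\<lambda>i j. f (g i) (g j)) xs"
  unfolding cyclic_prod_def rotate1_map zip_map_map by (simp add: case_prod_unfold comp_def)

lemma central_morphism_prod_list_rotate1:
  assumes "central_morphism \<tau>"
  shows "\<tau> (prod_list (rotate1 zs)) = \<tau> (prod_list zs)"
  using assms by (cases zs) (auto simp: central_morphism_def)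

lemma prod_list_zero_mem: "0 \<in> set zs \<Longrightarrow> prod_list zs = (0 :: 'r::{semiring_0,monoid_mult})"
  by (induction zs) auto

lemma central_morphism_cyclic_prod_rotate:
  assumes "central_morphism \<tau>"
  shows "\<tau> (cyclic_prod f (rotate n xs)) = \<tau> (cyclic_prod f xs)"
proof (induction n)
  case (Suc n)
  have "cyclic_prod f (rotate (Suc n) xs) =
      prod_list (rotate1 (map2 f (rotate n xs) (rotate1 (rotate n xs))))"
    by (simp add: cyclic_prod_def zip_rotate1_rotate1 rotate1_map)
  then show ?case
    using Suc central_morphism_prod_list_rotate1[OF assms] by (simp add: cyclic_prod_def)
qed simp

text \<open>
  A product along a cycle changes with the starting point when the factors do not commute, but
  only by moving factors from one end to the other, and \<open>\<tau>\<close> does not see this.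
\<close>

lemma central_morphism_cyclic_prod_cong:
  assumes "central_morphism \<tau>" "distinct xs" "distinct ys" "xs \<noteq> []"
    and "cycle_edges xs = cycle_edges ys"
  shows "\<tau> (cyclic_prod f xs) = \<tau> (cyclic_prod f ys)"
  using cycle_edges_eq_imp_rotate[OF assms(2-5)] central_morphism_cyclic_prod_rotate[OF assms(1)]
  by metis

lemma central_morphism_0: "central_morphism \<tau> \<Longrightarrow> \<tau> 0 = 0"
  unfolding central_morphism_def by (metis add_0 add_cancel_right_left)

lemma central_morphism_of_int_mult:
  assumes "central_morphism \<tau>"
  shows "\<tau> (of_int n * x) = of_int n * \<tau> x"
proof -
  have add: "\<tau> (u + w) = \<tau> u + \<tau> w" for u w using assms by (simp add: central_morphism_def)
  have minus: "\<tau> (- u) = - \<tau> u" for u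
    using add[of "- u" u] central_morphism_0[OF assms] by (simp add: eq_neg_iff_add_eq_0)
  have nat: "\<tau> (of_nat k * x) = of_nat k * \<tau> x" for k
    by (induction k) (simp_all add: add distrib_right central_morphism_0[OF assms])
  show ?thesis by (cases n rule: int_cases2) (simp_all add: nat minus)
qed

lemma mvpoly_induct:
  fixes p :: "('i, 'r::comm_monoid_add) mvpoly"
  assumes "\<And>k x. P (Poly_Mapping.single k x)" and "\<And>p q. P p \<Longrightarrow> P q \<Longrightarrow> P (p + q)"
  shows "P p"
proof -
  have "P (\<Sum>k\<in>A. Poly_Mapping.single k (Poly_Mapping.lookup p k))" if "finite A" for A
    using that
  proof induction
    case empty
    show ?case using assms(1)[of 0 0] by simp
  qed (simp add: assms)
  moreover have "(\<Sum>k\<in>Poly_Mapping.keys p. Poly_Mapping.single k (Poly_Mapping.lookup p k)) = p"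
    by (rule poly_mapping_eqI)
      (simp add: lookup_sum lookup_single when_def in_keys_iff)
  ultimately show ?thesis by (metis finite_keys)
qed

lemma coeffwise_single:
  "\<tau> 0 = 0 \<Longrightarrow> coeffwise \<tau> (Poly_Mapping.single k x) = Poly_Mapping.single k (\<tau> x)"
  by (auto intro!: poly_mapping_eqI simp: coeffwise_def map.rep_eq lookup_single when_def)

text \<open>
  The indeterminates commute with everything, so on monomials this is centrality of \<open>\<tau>\<close> on the
  coefficients; the general case follows by additivity in both arguments.
\<close>

lemma central_morphism_coeffwise:
  fixes \<tau> :: "'h::ring_1 \<Rightarrow> 'k::comm_ring_1"
  assumes "central_morphism \<tau>"
  shows "central_morphism (coeffwise \<tau> :: ('i, 'h) mvpoly \<Rightarrow> ('i, 'k) mvpoly)"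
proof -
  have zero: "\<tau> 0 = 0" by (rule central_morphism_0[OF assms])
  have add: "coeffwise \<tau> (p + q) = coeffwise \<tau> p + coeffwise \<tau> q" for p q :: "('i, 'h) mvpoly"
    using assms zero
    by (intro poly_mapping_eqI)
      (auto simp: coeffwise_def map.rep_eq lookup_add when_def central_morphism_def; metis add.left_neutral)
  have "coeffwise \<tau> (p * q) = coeffwise \<tau> (q * p)" for p q :: "('i, 'h) mvpoly"
  proof (induction p rule: mvpoly_induct)
    case (1 k x)
    show ?case
    proof (induction q rule: mvpoly_induct)
      case (1 l y)
      then show ?case
        using assms zero by (simp add: mult_single coeffwise_single add.commute central_morphism_def)
    qed (simp add: add distrib_left distrib_right)
  qed (simp add: add distrib_left distrib_right)
  with add show ?thesis by (simp add: central_morphism_def)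
qed

lemma central_morphism_sum:
  "central_morphism \<tau> \<Longrightarrow> \<tau> (\<Sum>i\<in>I. f i) = (\<Sum>i\<in>I. \<tau> (f i))"
  by (induction I rule: infinite_finite_induct)
    (simp_all add: central_morphism_0, simp add: central_morphism_def)

section \<open>Relabelling the determinant\<close>

lemma graph_on_map_permutation:
  assumes g: "inj_on g A"
  shows "graph_on (g ` A) (map_permutation A g p) = map_prod g g ` graph_on A p"
  using g by (auto simp: image_image map_permutation_apply intro!: image_cong)

text \<open>
  The determinant does not see how rows are numbered, so permutations of the index set
  \<open>{..<p}\<close> may be replaced by permutations of the set of labels. The list chosen to represent a
  relabelled cycle may differ from the relabelled list by a rotation, which centrality absorbs.
\<close>

lemma det_tau_relabel:
  fixes D :: "'a \<Rightarrow> 'a \<Rightarrow> ('i, 'h::ring_1) mvpoly" and \<tau> :: "'h \<Rightarrow> 'k::comm_ring_1"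
  assumes \<tau>: "central_morphism \<tau>" and g: "bij_betw g {..<p} U"
  shows "det_tau \<tau> p (\<lambda>i j. D (g i) (g j)) =
    (\<Sum>\<pi> | \<pi> permutes U. of_int (sign \<pi>) *
      (\<Prod>c\<in>directed_cycles (graph_on U \<pi>). coeffwise \<tau> (cyclic_prod D (cycle_vertices c))))"
  unfolding det_tau_def
proof (rule sum.reindex_bij_witness[where j = "map_permutation {..<p} g"
      and i = "map_permutation U (inv_into {..<p} g)"])
  have inj: "inj_on g {..<p}" and im: "g ` {..<p} = U" using g by (auto simp: bij_betw_def)
  fix \<pi> assume "\<pi> \<in> {\<pi>. \<pi> permutes {..<p}}"
  then have \<pi>: "\<pi> permutes {..<p}" by simp
  show "map_permutation U (inv_into {..<p} g) (map_permutation {..<p} g \<pi>) = \<pi>"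
    by (rule map_permutation_compose_inv[OF g \<pi>]) (simp add: inj inv_into_f_f)
  show "map_permutation {..<p} g \<pi> \<in> {\<pi>. \<pi> permutes U}"
    using map_permutation_permutes[OF g \<pi>] by simp
  let ?G = "graph_on {..<p} \<pi>"
  have G: "?G \<subseteq> {..<p} \<times> {..<p}" using \<pi> by (auto simp: permutes_in_image[OF \<pi>, unfolded lessThan_iff])
  have "inj_on ((`) (map_prod g g)) (directed_cycles ?G)"
  proof (rule inj_on_subset)
    show "inj_on ((`) (map_prod g g)) (Pow ({..<p} \<times> {..<p}))"
      by (intro inj_on_image_Pow map_prod_inj_on inj)
    show "directed_cycles ?G \<subseteq> Pow ({..<p} \<times> {..<p})"
      using G Union_directed_cycles_subset by blast
  qed
  moreover have "coeffwise \<tau> (cyclic_prod D (cycle_vertices (map_prod g g ` c))) =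
      coeffwise \<tau> (cyclic_prod (\<lambda>i j. D (g i) (g j)) (cycle_vertices c))"
    if c: "c \<in> directed_cycles ?G" for c
  proof -
    have "map_prod g g ` c \<in> directed_cycles (map_prod g g ` ?G)"
      using c directed_cycles_relabel[OF inj G] by blast
    note gc = cycle_vertices_props[OF this]
    note cv = cycle_vertices_props[OF c]
    have "set (cycle_vertices c) = fst ` c" using cv(3) fst_cycle_edges by metis
    then have "set (cycle_vertices c) \<subseteq> {..<p}" using c G by (fastforce simp: directed_cycles_def)
    then have "distinct (map g (cycle_vertices c))"
      using cv(2) inj by (auto simp: distinct_map intro: inj_on_subset)
    then show ?thesis
      unfolding cyclic_prod_map[symmetric]
      by (intro central_morphism_cyclic_prod_cong central_morphism_coeffwise \<tau>)
        (use gc cv in \<open>simp_all add: cycle_edges_map\<close>)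
  qed
  ultimately show "of_int (sign (map_permutation {..<p} g \<pi>)) *
      (\<Prod>c\<in>directed_cycles (graph_on U (map_permutation {..<p} g \<pi>)).
        coeffwise \<tau> (cyclic_prod D (cycle_vertices c))) =
    of_int (sign \<pi>) * (\<Prod>c\<in>directed_cycles ?G.
        coeffwise \<tau> (cyclic_prod (\<lambda>i j. D (g i) (g j)) (cycle_vertices c)))"
    unfolding im[symmetric] graph_on_map_permutation[OF inj] directed_cycles_relabel[OF inj G]
    using sign_map_permutation[OF inj \<pi>] by (simp add: prod.reindex cong: prod.cong)
next
  fix \<pi> assume "\<pi> \<in> {\<pi>. \<pi> permutes U}"
  then have \<pi>: "\<pi> permutes U" by simp
  show "map_permutation {..<p} g (map_permutation U (inv_into {..<p} g) \<pi>) = \<pi>"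
    by (rule map_permutation_compose_inv[OF bij_betw_inv_into[OF g] \<pi>])
      (use g in \<open>auto simp: bij_betw_def f_inv_into_f\<close>)
  show "map_permutation U (inv_into {..<p} g) \<pi> \<in> {\<pi>. \<pi> permutes {..<p}}"
    using map_permutation_permutes[OF bij_betw_inv_into[OF g] \<pi>] by simp
qed

section \<open>Products of entries of the Laplacian\<close>

lemma prod_list_single:
  fixes r :: "'e \<Rightarrow> 'h::ring_1"
  shows "prod_list (map (\<lambda>e. Poly_Mapping.single (k e) (r e)) es) =
    Poly_Mapping.single (sum_list (map k es)) (prod_list (map r es))"
  by (induction es) (simp_all add: mult_single)

text \<open>
  The integer factors are central, so they can be collected in front of a product whose other
  factors do not commute.
\<close>

lemma prod_list_neg_of_int_mult:
  fixes x :: "'e \<Rightarrow> 'h::ring_1"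
  shows "prod_list (map (\<lambda>e. - (of_int (s e) * x e)) es) =
    of_int ((- 1) ^ length es * prod_list (map s es)) * prod_list (map x es)"
proof (induction es)
  case (Cons e es)
  have "of_int (s e) * x e * (of_int n * y) = of_int (s e * n) * (x e * y)" for n y
    by (metis mult.assoc mult_of_int_commute of_int_mult)
  note move = this
  let ?n = "(- 1) ^ length es * prod_list (map s es)"
  have "prod_list (map (\<lambda>e. - (of_int (s e) * x e)) (e # es)) =
      - (of_int (s e) * x e * (of_int ?n * prod_list (map x es)))"
    using Cons by simp
  also have "\<dots> = of_int (- (s e * ?n)) * (x e * prod_list (map x es))"
    unfolding move by simp
  also have "- (s e * ?n) = (- 1) ^ length (e # es) * prod_list (map s (e # es))" by simp
  finally show ?case by simp
qed simp

lemma single_eq_Const_mult: "Poly_Mapping.single k (r::'k::comm_ring_1) = Const r * Poly_Mapping.single k 1"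
  by (simp add: Const_def mult_single)

text \<open>
  Along a repetition-free list the edges are distinct, so the monomial obtained by following the
  list is the product over the set of edges.
\<close>

lemma prod_Var_cycle_edges:
  assumes "distinct xs"
  shows "Poly_Mapping.single (sum_list (map (\<lambda>e. Poly_Mapping.single e 1) (zip xs (rotate1 xs)))) 1 =
    (\<Prod>e\<in>cycle_edges xs. Var e :: ('a \<times> 'a, 'k::comm_ring_1) mvpoly)"
proof -
  have "(\<Prod>e\<in>cycle_edges xs. Var e :: ('a \<times> 'a, 'k) mvpoly) =
      prod_list (map Var (zip xs (rotate1 xs)))"
    unfolding cycle_edges_def using assms by (simp add: prod.distinct_set_conv_list distinct_zipI1)
  then show ?thesis unfolding Var_def prod_list_single by (simp add: map_replicate_const)
qed

text \<open>
  All entries along the cycle are monomials, hence so is their cyclic product, and \<open>\<tau>\<close> acts on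
  its single coefficient.
\<close>

lemma coeffwise_cyclic_prod_edges:
  fixes h :: "'a \<Rightarrow> 'a \<Rightarrow> 'h::ring_1" and s :: "'a \<Rightarrow> 'a \<Rightarrow> int" and \<tau> :: "'h \<Rightarrow> 'k::comm_ring_1"
  assumes \<tau>: "central_morphism \<tau>" and xs: "distinct xs"
    and D: "\<And>i j. (i, j) \<in> cycle_edges xs \<Longrightarrow> D i j = - (of_int (s i j) * Const (h i j) * Var (i, j))"
  shows "coeffwise \<tau> (cyclic_prod D xs) =
    (- 1) ^ length xs * of_int (cyclic_prod s xs) * Const (\<tau> (cyclic_prod h xs)) *
    (\<Prod>e\<in>cycle_edges xs. Var e)"
proof -
  let ?es = "zip xs (rotate1 xs)"
  let ?r = "\<lambda>e. - (of_int (s (fst e) (snd e)) * h (fst e) (snd e))"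
  have entry: "- (of_int n * Const x * Var e) = Poly_Mapping.single (Poly_Mapping.single e 1) (- (of_int n * x))"
    for n and x :: 'h and e :: "'a \<times> 'a"
    by (simp add: Const_def Var_def mult_single single_uminus flip: single_of_int)
  have of_int_Const: "of_int n * Const x = (Const (of_int n * x) :: ('a \<times> 'a, 'k) mvpoly)" for n x
    by (simp add: Const_def mult_single flip: single_of_int)
  have "cyclic_prod D xs =
      prod_list (map (\<lambda>e. Poly_Mapping.single (Poly_Mapping.single e 1) (?r e)) ?es)"
    unfolding cyclic_prod_conv_edges
    by (rule arg_cong[of _ _ prod_list], rule map_cong) (auto simp: D cycle_edges_def entry)
  also have "\<dots> = Poly_Mapping.single (sum_list (map (\<lambda>e. Poly_Mapping.single e 1) ?es))
      (of_int ((- 1) ^ length xs * cyclic_prod s xs) * cyclic_prod h xs)"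
    unfolding prod_list_single prod_list_neg_of_int_mult cyclic_prod_conv_edges by simp
  finally have "coeffwise \<tau> (cyclic_prod D xs) =
      Const (of_int ((- 1) ^ length xs * cyclic_prod s xs) * \<tau> (cyclic_prod h xs)) *
      (\<Prod>e\<in>cycle_edges xs. Var e)"
    unfolding prod_Var_cycle_edges[OF xs, symmetric] single_eq_Const_mult[symmetric]
    by (simp only: coeffwise_single central_morphism_0[OF \<tau>] central_morphism_of_int_mult[OF \<tau>])
  also have "Const (of_int ((- 1) ^ length xs * cyclic_prod s xs) * \<tau> (cyclic_prod h xs)) =
      ((- 1) ^ length xs * of_int (cyclic_prod s xs) * Const (\<tau> (cyclic_prod h xs)) :: ('a \<times> 'a, 'k) mvpoly)"
    by (simp only: flip: of_int_Const) simp
  finally show ?thesis .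
qed

text \<open>
  The morphism sends \<open>1/d\<close> in the source to \<open>1/d\<close> in the target because it is unital and
  additive.
\<close>

lemma coeffwise_Delta_diag:
  assumes \<tau>: "central_morphism \<tau>" "\<tau> 1 = 1" and d: "\<exists>x::'h::ring_1. of_nat d * x = 1"
    and no_loop: "\<And>\<sigma>. (\<sigma>, \<sigma>) \<notin> edges v d"
  shows "coeffwise (\<tau> :: 'h \<Rightarrow> 'k::comm_ring_1) (Delta v d \<omega> h \<sigma> \<sigma>) =
    (\<Sum>e | e \<in> edges v d \<and> fst e = \<sigma>. Const (inv_of_nat d) * Var e)"
proof -
  let ?N = "{\<sigma>''. \<sigma>'' \<in> cells v d (d - 1) - {\<sigma>} \<and> (\<sigma>, \<sigma>'') \<in> edges v d}"
  obtain x :: 'h where x: "of_nat d * x = 1" using d by blast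
  have inv: "\<tau> (inv_of_nat d) = inv_of_nat d"
    using inv_of_nat_image(2)[OF \<tau> x] inv_of_nat_eqI[OF x] by simp
  have CV: "Const r * Var e = Poly_Mapping.single (Poly_Mapping.single e 1) r"
    for r :: "'r::ring_1" and e :: "nat set \<times> nat set"
    by (simp add: Const_def Var_def mult_single)
  have "coeffwise \<tau> (Delta v d \<omega> h \<sigma> \<sigma>) = (\<Sum>\<sigma>''\<in>?N. Const (inv_of_nat d) * Var (\<sigma>, \<sigma>''))"
    using no_loop
    by (simp add: Delta_def sum_distrib_left CV central_morphism_sum[OF central_morphism_coeffwise[OF \<tau>(1)]]
        coeffwise_single central_morphism_0[OF \<tau>(1)] inv)
  also have "\<dots> = (\<Sum>e | e \<in> edges v d \<and> fst e = \<sigma>. Const (inv_of_nat d) * Var e)"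
    by (rule sum.reindex_bij_witness[where i = snd and j = "Pair \<sigma>"])
      (use no_loop in \<open>auto simp: edges_def\<close>)
  finally show ?thesis .
qed

lemma cells_eq: "q \<le> d \<Longrightarrow> cells v d q = {\<sigma>. \<sigma> \<subseteq> {1..v} \<and> card \<sigma> = q + 1}"
  by (auto simp: cells_def skeleton_def)

lemma edges_no_loop: "d \<ge> 1 \<Longrightarrow> (\<sigma>, \<sigma>) \<notin> edges v d"
  by (auto simp: edges_def cells_def)

lemma finite_edges: "finite (edges v d)"
proof (rule finite_subset)
  show "edges v d \<subseteq> Pow {1..v} \<times> Pow {1..v}"
    by (auto simp: edges_def cells_def skeleton_def)
qed simp

lemma cycle_vertices_loop: "cycle_vertices {(i, i)} = [i]"
proof -
  note cv = cycle_vertices_props[OF loop_directed_cycle[of i "{(i, i)}"], simplified]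
  have "set (cycle_vertices {(i, i)}) = {i}"
    using fst_cycle_edges[of "cycle_vertices {(i, i)}"] cv(3) by simp
  then show ?thesis using cv(2)
    by (cases "cycle_vertices {(i, i)}") (auto simp: subset_singleton_iff)
qed

section \<open>The determinant as a sum over forests\<close>

theorem theorem6p1:
  fixes v d m :: nat
    and \<tau> :: "'h::ring_1 \<Rightarrow> 'k::comm_ring_1"
    and h :: "nat set \<Rightarrow> nat set \<Rightarrow> 'h"
    and \<omega> :: "nat set \<Rightarrow> int"
    and cs :: "nat set list"
  assumes "v \<ge> 2" and "d \<in> {1..v - 1}" and "m \<in> {1..v choose d}"
    and "central_morphism \<tau>" and "\<tau> 1 = 1"
    and "\<exists>x::'h. of_nat d * x = 1"
    and "is_orientation v d \<omega>"
    and "distinct cs" and "set cs = cells v d (d - 1)"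
  shows "det_tau \<tau> m (\<lambda>i j. Delta v d \<omega> h (cs ! i) (cs ! j)) =
    Const (inv_of_nat d) ^ m *
    (\<Sum>F \<in> forests (edges v d) (set (take m cs)).
       (\<Prod>e\<in>F. Var e) *
       (\<Prod>c \<in> directed_cycles F.
          1 - of_nat d ^ length (cycle_vertices c) *
              of_int (cyclic_prod (eps \<omega>) (cycle_vertices c)) *
              Const (\<tau> (cyclic_prod h (cycle_vertices c)))))"
proof -
  let ?E = "edges v d" and ?U = "set (take m cs)" and ?D = "Delta v d \<omega> h"
  let ?inv = "Const (inv_of_nat d) :: (nat set \<times> nat set, 'k) mvpoly"
  \<comment> \<open>With \<open>a\<^sub>e / d\<close> as the weight of the edge \<open>e\<close>, a cycle of length \<open>l\<close> carries a factor \<open>1 / d ^ l\<close>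
    that is absent from the off-diagonal entries; \<open>weight\<close> compensates it by \<open>d ^ l\<close>.\<close>
  define weight :: "(nat set \<times> nat set) set \<Rightarrow> (nat set \<times> nat set, 'k) mvpoly" where
    "weight c = - (of_nat d ^ length (cycle_vertices c) *
      of_int (cyclic_prod (eps \<omega>) (cycle_vertices c)) * Const (\<tau> (cyclic_prod h (cycle_vertices c))))" for c
  \<comment> \<open>The sign of a permutation is spread over its cycles, each giving \<open>- (- 1) ^ l\<close>. Together with
    the \<open>(- 1) ^ l\<close> from the entries \<open>- \<epsilon> h a\<close> this leaves \<open>- 1\<close> for every non-trivial cycle, and
    for a fixed point (\<open>l = 1\<close>) it leaves \<open>+ 1\<close>.\<close>
  define X :: "(nat set \<times> nat set) set \<Rightarrow> (nat set \<times> nat set, 'k) mvpoly" where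
    "X c = - ((- 1) ^ card c) * coeffwise \<tau> (cyclic_prod ?D (cycle_vertices c))" for c
  have d: "d \<ge> 1" using assms(2) by simp
  note no_loop = edges_no_loop[OF d]
  have "length cs = card (cells v d (d - 1))" using assms(8,9) distinct_card by metis
  also have "\<dots> = v choose d" using d n_subsets[of "{1..v}" d] by (simp add: cells_eq)
  finally have m: "m \<le> length cs" using assms(3) by simp
  have "bij_betw ((!) (take m cs)) {..<m} ?U"
    using assms(8) m by (intro bij_betw_nth) auto
  then have bij: "bij_betw (\<lambda>i. cs ! i) {..<m} ?U"
    by (rule bij_betw_cong[THEN iffD1, rotated]) simp
  obtain x :: 'h where x: "of_nat d * x = 1" using assms(6) by blast
  have "of_nat d * (inv_of_nat d :: 'k) = 1"
    using inv_of_nat_image[OF assms(4,5) x] by simp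
  then have inv: "of_nat d * ?inv = 1"
    by (simp add: Const_def mult_single flip: single_of_nat)

  have "det_tau \<tau> m (\<lambda>i j. ?D (cs ! i) (cs ! j)) =
      (\<Sum>\<pi> | \<pi> permutes ?U. of_int (sign \<pi>) *
        (\<Prod>c\<in>directed_cycles (graph_on ?U \<pi>). coeffwise \<tau> (cyclic_prod ?D (cycle_vertices c))))"
    by (rule det_tau_relabel[OF assms(4) bij])
  also have "\<dots> = (\<Sum>\<pi> | \<pi> permutes ?U. \<Prod>c\<in>directed_cycles (graph_on ?U \<pi>). X c)"
  proof (rule sum.cong[OF refl])
    fix \<pi> assume "\<pi> \<in> {\<pi>. \<pi> permutes ?U}"
    then have \<pi>: "\<pi> permutes ?U" by simp
    show "of_int (sign \<pi>) *
        (\<Prod>c\<in>directed_cycles (graph_on ?U \<pi>). coeffwise \<tau> (cyclic_prod ?D (cycle_vertices c))) =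
        (\<Prod>c\<in>directed_cycles (graph_on ?U \<pi>). X c)"
      unfolding sign_eq_prod_directed_cycles[OF \<pi> finite_set] X_def by (simp flip: prod.distrib)
  qed
  also have "\<dots> = (\<Sum>F\<in>forests ?E ?U.
      (\<Prod>e\<in>F. ?inv * Var e) * (\<Prod>c\<in>directed_cycles F. 1 + weight c))"
  proof (rule cycle_forest_expansion[OF finite_edges finite_set no_loop])
    fix \<sigma>
    show "X {(\<sigma>, \<sigma>)} = (\<Sum>e | e \<in> ?E \<and> fst e = \<sigma>. ?inv * Var e)"
      using coeffwise_Delta_diag[OF assms(4-6) no_loop]
      by (simp add: X_def cycle_vertices_loop cyclic_prod_def)
  next
    fix c assume c: "c \<in> directed_cycles ?E"
    note cv = cycle_vertices_props[OF c]
    let ?xs = "cycle_vertices c"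
    have cE: "c \<subseteq> ?E" using c by (auto simp: directed_cycles_def)
    have "coeffwise \<tau> (cyclic_prod ?D ?xs) = (- 1) ^ length ?xs * of_int (cyclic_prod (eps \<omega>) ?xs) *
        Const (\<tau> (cyclic_prod h ?xs)) * (\<Prod>e\<in>cycle_edges ?xs. Var e)"
    proof (rule coeffwise_cyclic_prod_edges[OF assms(4) cv(2)])
      fix i j assume "(i, j) \<in> cycle_edges ?xs"
      then have "(i, j) \<in> ?E" using cE cv(3) by auto
      then show "?D i j = - (of_int (eps \<omega> i j) * Const (h i j) * Var (i, j))"
        by (simp add: Delta_def)
    qed
    then have "X c = - (of_int (cyclic_prod (eps \<omega>) ?xs) * Const (\<tau> (cyclic_prod h ?xs)) * (\<Prod>e\<in>c. Var e))"
      unfolding X_def cv(3) length_cycle_vertices[OF c]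
      by (simp add: mult.assoc flip: power_mult_distrib)
    moreover have "weight c * (\<Prod>e\<in>c. ?inv * Var e) = (of_nat d * ?inv) ^ card c *
        - (of_int (cyclic_prod (eps \<omega>) ?xs) * Const (\<tau> (cyclic_prod h ?xs)) * (\<Prod>e\<in>c. Var e))"
      unfolding weight_def length_cycle_vertices[OF c] prod.distrib prod_constant power_mult_distrib
      by (simp add: mult_ac)
    ultimately show "X c = weight c * (\<Prod>e\<in>c. ?inv * Var e)" by (simp add: inv)
  next
    fix c assume c: "c \<in> directed_cycles (?U \<times> ?U)" and nl: "\<forall>i. (i, i) \<notin> c" and "\<not> c \<subseteq> ?E"
    note cv = cycle_vertices_props[OF c]
    obtain i j where ij: "(i, j) \<in> c" "(i, j) \<notin> ?E" using \<open>\<not> c \<subseteq> ?E\<close> by auto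
    then have "i \<noteq> j" using nl by auto
    then have "?D i j = 0" using ij by (simp add: Delta_def)
    moreover have "(i, j) \<in> set (zip (cycle_vertices c) (rotate1 (cycle_vertices c)))"
      using ij(1) cv(3) by (simp add: cycle_edges_def)
    ultimately have "0 \<in> set (map2 ?D (cycle_vertices c) (rotate1 (cycle_vertices c)))"
      by force
    then have "cyclic_prod ?D (cycle_vertices c) = 0"
      unfolding cyclic_prod_def by (metis prod_list_zero_mem)
    then show "X c = 0"
      by (simp add: X_def central_morphism_0[OF central_morphism_coeffwise[OF assms(4)]])
  qed
  also have "\<dots> = ?inv ^ m * (\<Sum>F\<in>forests ?E ?U.
      (\<Prod>e\<in>F. Var e) * (\<Prod>c\<in>directed_cycles F. 1 + weight c))"
    unfolding sum_distrib_left
  proof (rule sum.cong[OF refl])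
    fix F assume "F \<in> forests ?E ?U"
    then have "card F = m"
      using assms(8) m by (simp add: forests_def distinct_card)
    then show "(\<Prod>e\<in>F. ?inv * Var e) * (\<Prod>c\<in>directed_cycles F. 1 + weight c) =
        ?inv ^ m * ((\<Prod>e\<in>F. Var e) * (\<Prod>c\<in>directed_cycles F. 1 + weight c))"
      by (simp add: prod.distrib mult.assoc)
  qed
  finally show ?thesis by (simp add: weight_def)
qed

end
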